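(* Let $X$ be a Urysohn space with a regular $G_\delta$-diagonal. Then $|X|\le wL(X)^{\chi(X)}$.
   Context: A topological space $X$ is Urysohn if every two distinct points of $X$ have disjoint closed neighborhoods. Write $\Delta_X=\{(x,x)\in X^2:x\in X\}$. $X$ has a regular $G_\delta$-diagonal if there is a sequence $(U_n:n<\omega)$ of open sets in $X^2$ such that $\Delta_X=\bigcap_{n<\omega}U_n=\bigcap_{n<\omega}\overline{U_n}$. The weak Lindelöf number $wL(X)$ is the smallest infinite cardinal $\kappa$ such that every open cover of $X$ has a subcollection of cardinality $\le\kappa$ whose union is dense in $X$. The character $\chi(X)$ is the smallest infinite cardinal $\kappa$ such that every point of $X$ has a local base of cardinality $\le\kappa$. *)

theory Defs
  imports "HOL-Analysis.Analysis"
begin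

unbundle cardinal_syntax

definition Urysohn_space :: "'a topology \<Rightarrow> bool" where
  "Urysohn_space X \<longleftrightarrow>
    (\<forall>x\<in>topspace X. \<forall>y\<in>topspace X. x \<noteq> y \<longrightarrow>
      (\<exists>C D. closedin X C \<and> closedin X D \<and>
             x \<in> X interior_of C \<and> y \<in> X interior_of D \<and> C \<inter> D = {}))"

definition regular_G_delta_diagonal :: "'a topology \<Rightarrow> bool" where
  "regular_G_delta_diagonal X \<longleftrightarrow>
    (\<exists>U :: nat \<Rightarrow> ('a \<times> 'a) set.
      (\<forall>n. openin (prod_topology X X) (U n)) \<and>
      {(x, x) |x. x \<in> topspace X} = (\<Inter>n. U n) \<and>
      {(x, x) |x. x \<in> topspace X} = (\<Inter>n. prod_topology X X closure_of U n))"

text \<open>Cardinals are represented by cardinal well-orders (\<open>Card_order\<close>), compared with \<open>\<le>o\<close>; they are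
  determined only up to \<open>=o\<close>, hence the choice operator below.\<close>

definition least_infinite_cardinal :: "('k rel \<Rightarrow> bool) \<Rightarrow> 'k rel" where
  "least_infinite_cardinal P =
    (SOME \<kappa>. Cinfinite \<kappa> \<and> P \<kappa> \<and> (\<forall>\<kappa>'. Cinfinite \<kappa>' \<and> P \<kappa>' \<longrightarrow> \<kappa> \<le>o \<kappa>'))"

definition weakly_Lindelof_upto :: "'a topology \<Rightarrow> 'k rel \<Rightarrow> bool" where
  "weakly_Lindelof_upto X \<kappa> \<longleftrightarrow>
    (\<forall>\<U>. (\<forall>U\<in>\<U>. openin X U) \<and> \<Union>\<U> = topspace X \<longrightarrow>
      (\<exists>\<V>\<subseteq>\<U>. |\<V>| \<le>o \<kappa> \<and> X closure_of \<Union>\<V> = topspace X))"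

definition local_base_at :: "'a topology \<Rightarrow> 'a \<Rightarrow> 'a set set \<Rightarrow> bool" where
  "local_base_at X x \<B> \<longleftrightarrow>
    (\<forall>B\<in>\<B>. openin X B \<and> x \<in> B) \<and>
    (\<forall>U. openin X U \<and> x \<in> U \<longrightarrow> (\<exists>B\<in>\<B>. B \<subseteq> U))"

definition local_bases_upto :: "'a topology \<Rightarrow> 'k rel \<Rightarrow> bool" where
  "local_bases_upto X \<kappa> \<longleftrightarrow> (\<forall>x\<in>topspace X. \<exists>\<B>. local_base_at X x \<B> \<and> |\<B>| \<le>o \<kappa>)"

text \<open>The carrier type \<open>'a set + nat\<close> has room for the cardinal \<open>|{U. openin X U}| +c natLeq\<close>, which
  bounds both invariants. The lemmas \<open>weak_Lindelof_number\<close> and \<open>topological_character\<close> below show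
  that the values are the least infinite cardinals among cardinals on arbitrary types.\<close>

definition weak_Lindelof_number :: "'a topology \<Rightarrow> ('a set + nat) rel" where
  "weak_Lindelof_number X = least_infinite_cardinal (weakly_Lindelof_upto X)"

definition topological_character :: "'a topology \<Rightarrow> ('a set + nat) rel" where
  "topological_character X = least_infinite_cardinal (local_bases_upto X)"

lemma least_infinite_cardinal:
  assumes "Cinfinite \<kappa>\<^sub>0" and "P \<kappa>\<^sub>0"
  shows "Cinfinite (least_infinite_cardinal P)" and "P (least_infinite_cardinal P)"
    and "Cinfinite \<kappa> \<Longrightarrow> P \<kappa> \<Longrightarrow> least_infinite_cardinal P \<le>o \<kappa>"
proof -
  let ?R = "{\<kappa>. Cinfinite \<kappa> \<and> P \<kappa>}"
  have "\<exists>\<kappa>\<in>?R. \<forall>\<kappa>'\<in>?R. \<kappa> \<le>o \<kappa>'"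
    by (rule exists_minim_Card_order) (use assms in auto)
  then have "\<exists>\<kappa>. Cinfinite \<kappa> \<and> P \<kappa> \<and> (\<forall>\<kappa>'. Cinfinite \<kappa>' \<and> P \<kappa>' \<longrightarrow> \<kappa> \<le>o \<kappa>')"
    by blast
  from someI_ex[OF this]
  show "Cinfinite (least_infinite_cardinal P)" "P (least_infinite_cardinal P)"
    "Cinfinite \<kappa> \<Longrightarrow> P \<kappa> \<Longrightarrow> least_infinite_cardinal P \<le>o \<kappa>"
    unfolding least_infinite_cardinal_def by blast+
qed

lemma ordLess_imp_card_of_subset:
  fixes r :: "'a rel" and s :: "'b rel"
  assumes "Card_order r" and "r <o s"
  shows "\<exists>A :: 'b set. r =o |A|"
proof -
  have "|Field r| \<le>o |Field s|"
    using assms(2) by (intro card_of_mono2 ordLess_imp_ordLeq)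
  then obtain f where "inj_on f (Field r)" "f ` Field r \<subseteq> Field s"
    using card_of_ordLeq by metis
  then have "|Field r| =o |f ` Field r|"
    using card_of_ordIso inj_on_imp_bij_betw by blast
  then show ?thesis
    using assms(1) card_of_Field_ordIso ordIso_symmetric ordIso_transitive by blast
qed

lemma least_infinite_cardinal_le:
  fixes P :: "'k rel \<Rightarrow> bool" and Q :: "'l rel \<Rightarrow> bool"
  assumes "Cinfinite \<kappa>\<^sub>0" "P \<kappa>\<^sub>0"
    and iso: "\<And>\<kappa> \<kappa>'. Q \<kappa> \<Longrightarrow> \<kappa> =o \<kappa>' \<Longrightarrow> P \<kappa>'"
    and \<kappa>: "Cinfinite \<kappa>" "Q \<kappa>"
  shows "least_infinite_cardinal P \<le>o \<kappa>"
proof (rule ccontr)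
  let ?l = "least_infinite_cardinal P"
  note l = least_infinite_cardinal[of _ P, OF assms(1,2)]
  assume "\<not> ?l \<le>o \<kappa>"
  then have less: "\<kappa> <o ?l"
    using \<kappa>(1) l(1) by (meson card_order_on_well_order_on not_ordLeq_iff_ordLess)
  then obtain A :: "'k set" where A: "\<kappa> =o |A|"
    using \<kappa>(1) ordLess_imp_card_of_subset by blast
  then have "Cinfinite |A|"
    using \<kappa>(1) Cinfinite_cong by blast
  then have "?l \<le>o |A|"
    using l(3) iso \<kappa>(2) A by blast
  then have "?l \<le>o \<kappa>"
    using A ordIso_symmetric ordLeq_ordIso_trans by blast
  then show False
    using less not_ordLess_ordLeq by blast
qed

lemma Cinfinite_openin_csum:
  "Cinfinite ( |{U. openin X U}| +c natLeq )"
  by (simp add: Card_order_csum cinfinite_csum natLeq_cinfinite)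

lemma card_of_openin_le:
  assumes "\<V> \<subseteq> {U. openin X U}"
  shows "|\<V>| \<le>o |{U. openin X U}| +c natLeq"
  using assms by (meson card_of_Card_order card_of_mono1 ordLeq_csum1 ordLeq_transitive)

lemma weakly_Lindelof_upto_openin: "weakly_Lindelof_upto X ( |{U. openin X U}| +c natLeq )"
  unfolding weakly_Lindelof_upto_def
proof (intro allI impI)
  fix \<U> assume *: "(\<forall>U\<in>\<U>. openin X U) \<and> \<Union>\<U> = topspace X"
  then have "|\<U>| \<le>o |{U. openin X U}| +c natLeq"
    by (intro card_of_openin_le) auto
  then show "\<exists>\<V>\<subseteq>\<U>. |\<V>| \<le>o |{U. openin X U}| +c natLeq \<and> X closure_of \<Union>\<V> = topspace X"
    using * by (intro exI[of _ \<U>]) auto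
qed

lemma local_bases_upto_openin: "local_bases_upto X ( |{U. openin X U}| +c natLeq )"
  unfolding local_bases_upto_def
proof
  fix x
  have "|{U. openin X U \<and> x \<in> U}| \<le>o |{U. openin X U}| +c natLeq"
    by (rule card_of_openin_le) auto
  then show "\<exists>\<B>. local_base_at X x \<B> \<and> |\<B>| \<le>o |{U. openin X U}| +c natLeq"
    by (intro exI[of _ "{U. openin X U \<and> x \<in> U}"]) (auto simp: local_base_at_def)
qed

lemma weak_Lindelof_number:
  fixes X :: "'a topology" and \<kappa> :: "'k rel"
  shows "Cinfinite (weak_Lindelof_number X)"
    and "weakly_Lindelof_upto X (weak_Lindelof_number X)"
    and "Cinfinite \<kappa> \<Longrightarrow> weakly_Lindelof_upto X \<kappa> \<Longrightarrow> weak_Lindelof_number X \<le>o \<kappa>"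
proof -
  note w = Cinfinite_openin_csum[of X] weakly_Lindelof_upto_openin[of X]
  show "Cinfinite (weak_Lindelof_number X)" "weakly_Lindelof_upto X (weak_Lindelof_number X)"
    unfolding weak_Lindelof_number_def using least_infinite_cardinal(1,2)[of _ "weakly_Lindelof_upto X", OF w] by blast+
  show "weak_Lindelof_number X \<le>o \<kappa>" if "Cinfinite \<kappa>" "weakly_Lindelof_upto X \<kappa>"
    unfolding weak_Lindelof_number_def
  proof (rule least_infinite_cardinal_le[of _ "weakly_Lindelof_upto X" "weakly_Lindelof_upto X", OF w _ that])
    show "weakly_Lindelof_upto X \<kappa>''" if "weakly_Lindelof_upto X \<kappa>'" "\<kappa>' =o \<kappa>''"
      for \<kappa>' :: "'k rel" and \<kappa>'' :: "('a set + nat) rel"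
      using that unfolding weakly_Lindelof_upto_def by (meson ordLeq_ordIso_trans)
  qed
qed

lemma topological_character:
  fixes X :: "'a topology" and \<kappa> :: "'k rel"
  shows "Cinfinite (topological_character X)"
    and "local_bases_upto X (topological_character X)"
    and "Cinfinite \<kappa> \<Longrightarrow> local_bases_upto X \<kappa> \<Longrightarrow> topological_character X \<le>o \<kappa>"
proof -
  note w = Cinfinite_openin_csum[of X] local_bases_upto_openin[of X]
  show "Cinfinite (topological_character X)" "local_bases_upto X (topological_character X)"
    unfolding topological_character_def using least_infinite_cardinal(1,2)[of _ "local_bases_upto X", OF w] by blast+
  show "topological_character X \<le>o \<kappa>" if "Cinfinite \<kappa>" "local_bases_upto X \<kappa>"
    unfolding topological_character_def
  proof (rule least_infinite_cardinal_le[of _ "local_bases_upto X" "local_bases_upto X", OF w _ that])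
    show "local_bases_upto X \<kappa>''" if "local_bases_upto X \<kappa>'" "\<kappa>' =o \<kappa>''"
      for \<kappa>' :: "'k rel" and \<kappa>'' :: "('a set + nat) rel"
      using that unfolding local_bases_upto_def by (meson ordLeq_ordIso_trans)
  qed
qed

end

theory Submission
  imports Defs
begin

text \<open>Let \<open>U\<^sub>n\<close> witness the regular \<open>G\<^sub>\<delta>\<close>-diagonal and cover \<open>X\<close> by the open sets \<open>V\<close> with
  \<open>V \<times> V \<subseteq> U\<^sub>n\<close>; weak Lindelofness leaves at most \<open>wL(X)\<close> of them, with dense union, for each \<open>n\<close>.
  Index a local base \<open>B(x, \<alpha>)\<close> at every point by \<open>\<alpha> < \<chi>(X)\<close>, and let \<open>F\<^sub>x(n, \<alpha>, \<beta>)\<close> be one of the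
  chosen \<open>V\<close> that meets \<open>B(x, \<alpha>) \<inter> B(x, \<beta>)\<close>. For \<open>x \<noteq> y\<close> some \<open>B(x, \<alpha>) \<times> B(y, \<beta>)\<close> misses some
  \<open>U\<^sub>n\<close>, so no \<open>V\<close> for this \<open>n\<close> meets both factors and \<open>F\<^sub>x(n, \<alpha>, \<beta>) \<noteq> F\<^sub>y(n, \<alpha>, \<beta>)\<close>. Hence
  \<open>x \<mapsto> F\<^sub>x\<close> is injective, with values in the functions from \<open>\<omega> \<times> \<chi>(X) \<times> \<chi>(X)\<close> to \<open>wL(X)\<close>.\<close>

text \<open>A pair off the diagonal lies outside the closure of some \<open>U n\<close>, so a whole
  basic open rectangle around it misses \<open>U n\<close>.\<close>

lemma regular_G_delta_diagonalE:
  assumes "regular_G_delta_diagonal X"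
  obtains U :: "nat \<Rightarrow> ('a \<times> 'a) set"
  where "\<And>n. openin (prod_topology X X) (U n)"
    and "\<And>n x. x \<in> topspace X \<Longrightarrow> (x, x) \<in> U n"
    and "\<And>x y. \<lbrakk>x \<in> topspace X; y \<in> topspace X; x \<noteq> y\<rbrakk> \<Longrightarrow>
           \<exists>n A B. openin X A \<and> openin X B \<and> x \<in> A \<and> y \<in> B \<and> A \<times> B \<inter> U n = {}"
proof -
  obtain U :: "nat \<Rightarrow> ('a \<times> 'a) set"
    where op: "\<And>n. openin (prod_topology X X) (U n)"
      and diag: "{(x, x) |x. x \<in> topspace X} = (\<Inter>n. U n)"
      and diag_closure: "{(x, x) |x. x \<in> topspace X} = (\<Inter>n. prod_topology X X closure_of U n)"
    using assms unfolding regular_G_delta_diagonal_def by (elim exE conjE) (rule that, auto)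
  show thesis
  proof (rule that[of U])
    fix x y assume xy: "x \<in> topspace X" "y \<in> topspace X" "x \<noteq> y"
    then have "(x, y) \<notin> (\<Inter>n. prod_topology X X closure_of U n)"
      unfolding diag_closure[symmetric] by simp
    then obtain n where "(x, y) \<notin> prod_topology X X closure_of U n"
      by auto
    then obtain T where "openin (prod_topology X X) T" "(x, y) \<in> T" "T \<inter> U n = {}"
      using xy by (fastforce simp: in_closure_of)
    moreover from this obtain A B
      where "openin X A" "openin X B" "x \<in> A" "y \<in> B" "A \<times> B \<subseteq> T"
      unfolding openin_prod_topology_alt by meson
    ultimately have "openin X A \<and> openin X B \<and> x \<in> A \<and> y \<in> B \<and> A \<times> B \<inter> U n = {}"
      by auto
    then show "\<exists>n A B. openin X A \<and> openin X B \<and> x \<in> A \<and> y \<in> B \<and> A \<times> B \<inter> U n = {}"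
      by meson
  next
    show "(x, x) \<in> U n" if "x \<in> topspace X" for n x
      using that diag by auto
  qed (rule op)
qed

text \<open>A basic rectangle \<open>A \<times> B\<close> around \<open>(x, x)\<close> inside
  \<open>W\<close> contains the square of \<open>A \<inter> B\<close>. Hence the open sets with
  square in \<open>W\<close> cover the space.\<close>

lemma weakly_Lindelof_dense_squares:
  assumes "weakly_Lindelof_upto X \<kappa>"
    and "openin (prod_topology X X) W" and "\<And>x. x \<in> topspace X \<Longrightarrow> (x, x) \<in> W"
  obtains \<V> where "\<And>V. V \<in> \<V> \<Longrightarrow> V \<times> V \<subseteq> W" and "|\<V>| \<le>o \<kappa>"
    and "X closure_of \<Union>\<V> = topspace X"
proof -
  let ?\<U> = "{V. openin X V \<and> V \<times> V \<subseteq> W}"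
  have "\<exists>V\<in>?\<U>. x \<in> V" if x: "x \<in> topspace X" for x
  proof -
    obtain A B where "openin X A" "openin X B" "x \<in> A" "x \<in> B" "A \<times> B \<subseteq> W"
      using assms(2) assms(3)[OF x] unfolding openin_prod_topology_alt by meson
    then show ?thesis
      by (intro bexI[of _ "A \<inter> B"]) auto
  qed
  then have "\<Union>?\<U> = topspace X"
    by (auto dest: openin_subset)
  moreover have "\<forall>V\<in>?\<U>. openin X V"
    by simp
  ultimately have "\<exists>\<V>\<subseteq>?\<U>. |\<V>| \<le>o \<kappa> \<and> X closure_of \<Union>\<V> = topspace X"
    using assms(1) unfolding weakly_Lindelof_upto_def by meson
  then obtain \<V> where "\<V> \<subseteq> ?\<U>" "|\<V>| \<le>o \<kappa>" "X closure_of \<Union>\<V> = topspace X"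
    by meson
  then show thesis
    by (intro that[of \<V>]) auto
qed

text \<open>A base of size at most \<open>\<kappa>\<close> is nonempty, since the whole space is a
  neighborhood of \<open>x\<close>; so \<open>Field \<kappa>\<close> maps onto it, possibly with
  repetitions.\<close>

lemma local_base_at_enumeration:
  assumes "local_bases_upto X \<kappa>" and "Card_order \<kappa>" and "x \<in> topspace X"
  obtains B where "local_base_at X x (B ` Field \<kappa>)"
proof -
  obtain \<B> where base: "local_base_at X x \<B>" and card: "|\<B>| \<le>o \<kappa>"
    using assms unfolding local_bases_upto_def by blast
  have "\<B> \<noteq> {}"
    using base assms(3) unfolding local_base_at_def by (metis empty_iff openin_topspace)
  moreover have "|\<B>| \<le>o |Field \<kappa>|"
    using card assms(2) card_of_Field_ordIso ordIso_symmetric ordLeq_ordIso_trans by blast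
  ultimately obtain B where "B ` Field \<kappa> = \<B>"
    using card_of_ordLeq2 by metis
  then show thesis
    using base that by blast
qed

text \<open>Triples get coded by single elements of \<open>Field \<kappa>\<close>, so that the
  exponent in the final bound stays a single cardinal.\<close>

lemma Cinfinite_surj_nat_times_square:
  assumes "Cinfinite \<kappa>"
  obtains p where "p ` Field \<kappa> = (UNIV :: nat set) \<times> Field \<kappa> \<times> Field \<kappa>"
proof -
  let ?K = "Field \<kappa>"
  have inf: "infinite ?K"
    using assms by (simp add: cinfinite_def)
  then have "|UNIV :: nat set| \<le>o |?K|"
    by (simp add: infinite_iff_card_of_nat)
  moreover have "|?K \<times> ?K| \<le>o |?K|"
    using inf card_of_Times_same_infinite ordIso_imp_ordLeq by blast
  ultimately have "|(UNIV :: nat set) \<times> ?K \<times> ?K| \<le>o |?K|"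
    using inf by (intro card_of_Times_ordLeq_infinite_Field) (simp_all add: Field_card_of card_of_card_order_on card_of_mono1)
  moreover have "(UNIV :: nat set) \<times> ?K \<times> ?K \<noteq> {}"
    using inf by auto
  ultimately show thesis
    using that card_of_ordLeq2 by metis
qed

lemma regular_G_delta_diagonal_card_le:
  fixes X :: "'a topology" and \<kappa> :: "'k rel" and \<mu> :: "'l rel"
  assumes diag: "regular_G_delta_diagonal X"
    and \<kappa>: "Card_order \<kappa>" "weakly_Lindelof_upto X \<kappa>"
    and \<mu>: "Cinfinite \<mu>" "local_bases_upto X \<mu>"
  shows "|topspace X| \<le>o \<kappa> ^c \<mu>"
proof -
  let ?K = "Field \<kappa>" and ?M = "Field \<mu>"
  obtain U :: "nat \<Rightarrow> ('a \<times> 'a) set"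
    where U: "\<And>n. openin (prod_topology X X) (U n)"
      "\<And>n x. x \<in> topspace X \<Longrightarrow> (x, x) \<in> U n"
    and sep: "\<And>x y. \<lbrakk>x \<in> topspace X; y \<in> topspace X; x \<noteq> y\<rbrakk> \<Longrightarrow>
      \<exists>n A B. openin X A \<and> openin X B \<and> x \<in> A \<and> y \<in> B \<and> A \<times> B \<inter> U n = {}"
    using regular_G_delta_diagonalE[OF diag] by blast
  have "\<exists>\<V>. (\<forall>V\<in>\<V>. V \<times> V \<subseteq> U n) \<and> |\<V>| \<le>o \<kappa> \<and> X closure_of \<Union>\<V> = topspace X" for n
    using weakly_Lindelof_dense_squares[OF \<kappa>(2) U(1) U(2)] by metis
  then obtain \<V> where \<V>: "\<And>n V. V \<in> \<V> n \<Longrightarrow> V \<times> V \<subseteq> U n" "\<And>n. |\<V> n| \<le>o \<kappa>"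
    "\<And>n. X closure_of \<Union>(\<V> n) = topspace X"
    by metis
  have "|\<V> n| \<le>o |?K|" for n
    using \<V>(2) \<kappa>(1) card_of_Field_ordIso ordIso_symmetric ordLeq_ordIso_trans by blast
  then have "\<exists>g. inj_on g (\<V> n) \<and> g ` \<V> n \<subseteq> ?K" for n
    by (simp add: card_of_ordLeq)
  \<comment> \<open>\<open>g n\<close> codes the members of \<open>\<V> n\<close> by elements of
    \<open>?K\<close>, which gives all \<open>n\<close> a common set of values.\<close>
  then obtain g where g: "\<And>n. inj_on (g n) (\<V> n)" "\<And>n. g n ` \<V> n \<subseteq> ?K"
    by metis
  have "\<exists>B. local_base_at X x (B ` ?M)" if "x \<in> topspace X" for x
    using local_base_at_enumeration[OF \<mu>(2) _ that] \<mu>(1) by blast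
  then obtain B where base: "\<And>x. x \<in> topspace X \<Longrightarrow> local_base_at X x (B x ` ?M)"
    by metis
  obtain p where p: "p ` ?M = (UNIV :: nat set) \<times> ?M \<times> ?M"
    using Cinfinite_surj_nat_times_square[OF \<mu>(1)] .
  have meet: "\<exists>V. V \<in> \<V> n \<and> V \<inter> (B x a \<inter> B x b) \<noteq> {}"
    if "x \<in> topspace X" "a \<in> ?M" "b \<in> ?M" for n x a b
  proof -
    have "openin X (B x a \<inter> B x b)" "x \<in> B x a \<inter> B x b"
      using base[OF that(1)] that(2,3) by (auto simp: local_base_at_def)
    moreover have "x \<in> X closure_of \<Union>(\<V> n)"
      using \<V>(3) that(1) by simp
    ultimately show ?thesis
      unfolding in_closure_of by blast
  qed
  define F where "F x n a b = (SOME V. V \<in> \<V> n \<and> V \<inter> (B x a \<inter> B x b) \<noteq> {})" for x n a b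
  have F: "F x n a b \<in> \<V> n \<and> F x n a b \<inter> (B x a \<inter> B x b) \<noteq> {}"
    if "x \<in> topspace X" "a \<in> ?M" "b \<in> ?M" for x n a b
    unfolding F_def by (rule someI_ex[OF meet[OF that]])
  \<comment> \<open>\<open>G x\<close> is \<open>F x\<close> with arguments decoded by
    \<open>p\<close> and values coded by \<open>g\<close>. Membership in \<open>Func\<close>
    requires the value \<open>undefined\<close> outside \<open>?M\<close>.\<close>
  define G where "G x k = (if k \<in> ?M then case p k of (n, a, b) \<Rightarrow> g n (F x n a b) else undefined)"
    for x k
  have "inj_on G (topspace X)"
  proof (rule inj_onI, rule ccontr)
    fix x y assume xy: "x \<in> topspace X" "y \<in> topspace X" "G x = G y" "x \<noteq> y"
    obtain n A C where AC: "openin X A" "openin X C" "x \<in> A" "y \<in> C" "A \<times> C \<inter> U n = {}"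
      using sep[OF xy(1,2,4)] by blast
    obtain a where a: "a \<in> ?M" "B x a \<subseteq> A"
      using base[OF xy(1)] AC(1,3) unfolding local_base_at_def by blast
    obtain b where b: "b \<in> ?M" "B y b \<subseteq> C"
      using base[OF xy(2)] AC(2,4) unfolding local_base_at_def by blast
    have "(n, a, b) \<in> p ` ?M"
      using p a(1) b(1) by simp
    then obtain k where k: "k \<in> ?M" "p k = (n, a, b)"
      by force
    have "g n (F x n a b) = g n (F y n a b)"
      using fun_cong[OF xy(3), of k] k by (simp add: G_def)
    then have eq: "F x n a b = F y n a b"
      using F[OF xy(1) a(1) b(1)] F[OF xy(2) a(1) b(1)] inj_onD[OF g(1)] by blast
    \<comment> \<open>The same pair \<open>(a, b)\<close> indexes both points: the first index is
      used at \<open>x\<close>, the second at \<open>y\<close>. The common set \<open>V\<close> then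
      meets \<open>A\<close> and \<open>C\<close>, so \<open>V \<times> V \<subseteq> U n\<close>
      has a point in \<open>A \<times> C\<close>.\<close>
    obtain u v where "u \<in> F x n a b \<inter> B x a" "v \<in> F x n a b \<inter> B y b"
      using F[OF xy(1) a(1) b(1), of n] F[OF xy(2) a(1) b(1), of n] eq by auto
    moreover have "F x n a b \<times> F x n a b \<subseteq> U n"
      using F[OF xy(1) a(1) b(1)] \<V>(1) by blast
    ultimately show False
      using AC(5) a(2) b(2) by blast
  qed
  moreover have "G ` topspace X \<subseteq> Func ?M ?K"
  proof (rule image_subsetI)
    fix x assume x: "x \<in> topspace X"
    have "G x k \<in> ?K" if k: "k \<in> ?M" for k
    proof -
      obtain n a b where nab: "p k = (n, a, b)"
        by (cases "p k") auto
      moreover have "p k \<in> UNIV \<times> ?M \<times> ?M"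
        using p k by blast
      ultimately have "F x n a b \<in> \<V> n"
        using F[OF x] by auto
      then show ?thesis
        using g(2) k nab by (auto simp: G_def)
    qed
    then show "G x \<in> Func ?M ?K"
      by (simp add: Func_def G_def)
  qed
  ultimately show ?thesis
    unfolding cexp_def using card_of_ordLeq by blast
qed

theorem corollary4p7:
  fixes X :: "'a topology"
  assumes "Urysohn_space X" and "regular_G_delta_diagonal X"
  shows "|topspace X| \<le>o weak_Lindelof_number X ^c topological_character X"
  using regular_G_delta_diagonal_card_le[OF assms(2) _ weak_Lindelof_number(2)
      topological_character(1,2)] weak_Lindelof_number(1) by blast

end
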